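(* Let $q$ be a prime power, $m,l,k$ integers with $3\le k\le\min\{m+1,l\}$, and $1\le r\le k-1$. Let $\langle 1,u_1,\dots,u_r\rangle$ be an $(r+1)$-dimensional $\mathrm{GF}(q)$-subspace of $\mathrm{GF}(q^l)$. Then the size of the stabilizer of $T(u_1,\dots,u_r)$ in $G$ is $$\bigl|G_{T(u_1,\dots,u_r)}\bigr|=\bigl|H_{\langle 1,u_1,\dots,u_r\rangle}\bigr|\prod_{i=r+1}^{k-1}(q^k-q^i)\prod_{i=k-1}^{m-1}(q^{ml}-q^{il}).$$
   Context: Empty products equal $1$. $V$ is an $m$-dimensional vector space over $\mathrm{GF}(q^l)$ with basis $Y_1,\dots,Y_m$, regarded also as an $ml$-dimensional space over $\mathrm{GF}(q)$. $G=\mathrm{GL}(m,q^l)$ acts $\mathrm{GF}(q^l)$-linearly on $V$ and hence on its $\mathrm{GF}(q)$-subspaces; $G_W=\{g\in G:g(W)=W\}$. $H$ is a Singer cycle of $\mathrm{GF}(q^l)$, i.e. the group of multiplications by elements of $\mathrm{GF}(q^l)^*$, acting on the $\mathrm{GF}(q)$-subspaces of $\mathrm{GF}(q^l)$; $H_W$ is the stabilizer of $W$ in $H$. $\langle\cdot\rangle$ denotes $\mathrm{GF}(q)$-span. For $u_1,\dots,u_r\in\mathrm{GF}(q^l)$ with $1,u_1,\dots,u_r$ linearly independent over $\mathrm{GF}(q)$, $$T(u_1,\dots,u_r)=\langle Y_1,\dots,Y_{k-1},\,u_1Y_1+\cdots+u_rY_r\rangle,$$ a $k$-dimensional $\mathrm{GF}(q)$-subspace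 of $V$. *)

theory Defs
  imports
    "HOL-Library.Cardinality"
    "HOL-Number_Theory.Prime_Powers"
begin

text \<open>
  The extension of finite fields is given by two finite field types, \<open>'k\<close> for the ground
  field and \<open>'e\<close> for the extension, and an embedding \<open>\<phi> :: 'k \<Rightarrow> 'e\<close> (a unital ring homomorphism
  between fields is automatically injective). Vector spaces are described by their scalar
  multiplication, as in \<^theory>\<open>HOL.Vector_Spaces\<close>.
\<close>

definition field_embedding :: "('k::field \<Rightarrow> 'e::field) \<Rightarrow> bool" where
  "field_embedding \<phi> \<longleftrightarrow>
     \<phi> 1 = 1 \<and> (\<forall>x y. \<phi> (x + y) = \<phi> x + \<phi> y) \<and> (\<forall>x y. \<phi> (x * y) = \<phi> x * \<phi> y)"

definition restrict_scale :: "('k \<Rightarrow> 'e) \<Rightarrow> ('e \<Rightarrow> 'v \<Rightarrow> 'v) \<Rightarrow> 'k \<Rightarrow> 'v \<Rightarrow> 'v" where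
  "restrict_scale \<phi> scale c x = scale (\<phi> c) x"

definition is_basis ::
  "('e::field \<Rightarrow> 'v::ab_group_add \<Rightarrow> 'v) \<Rightarrow> nat \<Rightarrow> (nat \<Rightarrow> 'v) \<Rightarrow> bool" where
  "is_basis scale m Y \<longleftrightarrow>
     inj_on Y {1..m} \<and> \<not> module.dependent scale (Y ` {1..m}) \<and>
     module.span scale (Y ` {1..m}) = UNIV"

definition GL :: "('e::field \<Rightarrow> 'v::ab_group_add \<Rightarrow> 'v) \<Rightarrow> ('v \<Rightarrow> 'v) set" where
  "GL scale = {g. Vector_Spaces.linear scale scale g \<and> bij g}"

definition singer_cycle :: "('e::field \<Rightarrow> 'e) set" where
  "singer_cycle = {(*) a | a. a \<noteq> 0}"

definition stabilizer :: "('v \<Rightarrow> 'v) set \<Rightarrow> 'v set \<Rightarrow> ('v \<Rightarrow> 'v) set" where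
  "stabilizer G W = {g \<in> G. g ` W = W}"

definition T_subspace ::
  "('k::field \<Rightarrow> 'e::field) \<Rightarrow> ('e \<Rightarrow> 'v::ab_group_add \<Rightarrow> 'v) \<Rightarrow> (nat \<Rightarrow> 'v) \<Rightarrow>
   nat \<Rightarrow> nat \<Rightarrow> (nat \<Rightarrow> 'e) \<Rightarrow> 'v set" where
  "T_subspace \<phi> scale Y k r u =
     module.span (restrict_scale \<phi> scale)
       (insert (\<Sum>i=1..r. scale (u i) (Y i)) (Y ` {1..k-1}))"

end

theory Submission
  imports Defs
begin

text \<open>
  An element \<open>g\<close> of the stabilizer is determined by the tuple of images of \<open>w, Y\<^sub>1, \<dots>, Y\<^sub>m\<close>,
  where \<open>w = \<Sum>j\<le>r. u\<^sub>j Y\<^sub>j\<close>. These tuples are chosen in three steps.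
  The images of \<open>w, Y\<^sub>1, \<dots>, Y\<^sub>r\<close> must lie in \<open>T\<close> and satisfy the same linear relation;
  comparing coefficients, such independent tuples correspond to the scalars \<open>a \<noteq> 0\<close> with
  \<open>a U = U\<close>, through the transposed matrix of multiplication by \<open>a\<close> in the basis
  \<open>- 1, u\<^sub>1, \<dots>, u\<^sub>r\<close> of \<open>U\<close>.
  The images of \<open>Y\<^sub>r\<^sub>+\<^sub>1, \<dots>, Y\<^sub>k\<^sub>-\<^sub>1\<close> are then arbitrary in \<open>T\<close> up to independence over
  \<open>GF(q)\<close>, and those of \<open>Y\<^sub>k, \<dots>, Y\<^sub>m\<close> arbitrary in \<open>V\<close> up to independence over
  \<open>GF(q\<^sup>l)\<close>. The two notions of independence agree after the second step: \<open>k\<close> vectors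
  of \<open>T\<close> that are independent over \<open>GF(q)\<close> span \<open>T\<close>, hence span
  \<open>Y\<^sub>1, \<dots>, Y\<^sub>k\<^sub>-\<^sub>1\<close> over \<open>GF(q\<^sup>l)\<close>.
\<close>

text \<open>A separate locale, since facts added to \<open>vector_space\<close> itself would be shadowed by
  their copies under its global interpretation for real vector spaces.\<close>

locale finite_field_space = vector_space scale
  for scale :: "'a::{field,finite} \<Rightarrow> 'b::ab_group_add \<Rightarrow> 'b" (infixr "*s" 75)
begin

section \<open>Indexed families of vectors: independence and spans\<close>

text \<open>Tuples are counted later, and a set forgets repeated entries; hence injectivity is part
  of the notion.\<close>

definition indep_family :: "('i \<Rightarrow> 'b) \<Rightarrow> 'i set \<Rightarrow> bool" where
  "indep_family h I \<longleftrightarrow> inj_on h I \<and> independent (h ` I)"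

lemma indep_family_insert:
  assumes "a \<notin> I"
  shows "indep_family h (insert a I) \<longleftrightarrow> indep_family h I \<and> h a \<notin> span (h ` I)"
  using assms span_base[of "h a" "h ` I"]
  by (auto simp: indep_family_def independent_insert split: if_splits)

lemma indep_family_subset: "indep_family h I \<Longrightarrow> J \<subseteq> I \<Longrightarrow> indep_family h J"
  unfolding indep_family_def by (meson image_mono independent_mono inj_on_subset)

lemma indep_family_cong:
  assumes "\<And>i. i \<in> I \<Longrightarrow> h i = h' i"
  shows "indep_family h I \<longleftrightarrow> indep_family h' I"
proof -
  have "h ` I = h' ` I" "inj_on h I \<longleftrightarrow> inj_on h' I"
    using assms by (auto cong: inj_on_cong)
  then show ?thesis by (simp add: indep_family_def)
qed

lemma indep_family_iff:
  assumes "finite I"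
  shows "indep_family h I \<longleftrightarrow> (\<forall>c. (\<Sum>i\<in>I. c i *s h i) = 0 \<longrightarrow> (\<forall>i\<in>I. c i = 0))"
proof
  assume ind: "indep_family h I"
  show "\<forall>c. (\<Sum>i\<in>I. c i *s h i) = 0 \<longrightarrow> (\<forall>i\<in>I. c i = 0)"
  proof (intro allI impI ballI)
    fix c i assume s: "(\<Sum>i\<in>I. c i *s h i) = 0" and i: "i \<in> I"
    have inj: "inj_on h I" and "independent (h ` I)"
      using ind by (auto simp: indep_family_def)
    have "(\<Sum>v\<in>h ` I. c (the_inv_into I h v) *s v) = (\<Sum>i\<in>I. c i *s h i)"
      by (simp add: sum.reindex[OF inj] the_inv_into_f_f[OF inj])
    then have "c (the_inv_into I h (h i)) = 0"
      using s i \<open>independent (h ` I)\<close> assms dependent_finite[of "h ` I"] by auto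
    then show "c i = 0" by (simp add: the_inv_into_f_f[OF inj i])
  qed
next
  assume *: "\<forall>c. (\<Sum>i\<in>I. c i *s h i) = 0 \<longrightarrow> (\<forall>i\<in>I. c i = 0)"
  have inj: "inj_on h I"
  proof (rule inj_onI, rule ccontr)
    fix a b assume ab: "a \<in> I" "b \<in> I" "h a = h b" "a \<noteq> b"
    \<comment> \<open>Two equal entries satisfy the relation with coefficients 1 and -1, which is
      nontrivial.\<close>
    define e :: "_ \<Rightarrow> 'a" where "e = (\<lambda>i. if i = a then 1 else if i = b then - 1 else 0)"
    have "(\<Sum>i\<in>I. e i *s h i) = (\<Sum>i\<in>{a, b}. e i *s h i)"
      using ab assms by (intro sum.mono_neutral_right) (auto simp: e_def)
    also have "\<dots> = 0" using ab by (simp add: e_def)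
    finally have "\<forall>i\<in>I. e i = 0" by (rule *[THEN spec, of e, THEN mp])
    then have "e a = 0" using ab(1) by (rule bspec)
    then show False by (simp add: e_def)
  qed
  moreover have "independent (h ` I)"
  proof
    assume "dependent (h ` I)"
    then obtain d v where v: "v \<in> h ` I" "d v \<noteq> 0" and s: "(\<Sum>v\<in>h ` I. d v *s v) = 0"
      using assms dependent_finite[of "h ` I"] by auto
    have "(\<Sum>i\<in>I. d (h i) *s h i) = 0"
      using s by (simp add: sum.reindex[OF inj])
    then have "\<forall>i\<in>I. d (h i) = 0" by (rule *[THEN spec, of "\<lambda>i. d (h i)", THEN mp])
    then show False using v by auto
  qed
  ultimately show "indep_family h I" by (simp add: indep_family_def)
qed

lemma indep_family_unique:
  assumes "finite I" "indep_family h I" "(\<Sum>i\<in>I. c i *s h i) = (\<Sum>i\<in>I. d i *s h i)" "i \<in> I"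
  shows "c i = d i"
proof -
  have "(\<Sum>i\<in>I. (c i - d i) *s h i) = 0"
    using assms(3) by (simp add: scale_left_diff_distrib sum_subtractf)
  moreover note assms(2)[unfolded indep_family_iff[OF assms(1)], THEN spec, of "\<lambda>i. c i - d i"]
  ultimately show ?thesis using assms(4) by simp
qed

lemma indep_family_if_card_le:
  assumes I: "finite I"
    and le: "\<And>B. B \<subseteq> h ` I \<Longrightarrow> independent B \<Longrightarrow> h ` I \<subseteq> span B \<Longrightarrow> card I \<le> card B"
  shows "indep_family h I"
proof -
  obtain B where B: "B \<subseteq> h ` I" "independent B" "h ` I \<subseteq> span B"
    using maximal_independent_subset[of "h ` I"] by blast
  have "card I \<le> card B" using le[OF B] .
  moreover have "card B \<le> card (h ` I)" using B(1) I by (simp add: card_mono)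
  moreover have "card (h ` I) \<le> card I" using I by (rule card_image_le)
  ultimately have "card (h ` I) = card I" "card B = card (h ` I)" by auto
  then show ?thesis
    using B I card_subset_eq[of "h ` I" B] by (auto simp: indep_family_def intro: eq_card_imp_inj_on)
qed

text \<open>By Steinitz exchange: a set spanning all \<open>h' i\<close> also spans the independent
  \<open>h i\<close>, so it has at least \<open>card I\<close> elements.\<close>

lemma indep_family_if_spans:
  assumes I: "finite I" and h: "indep_family h I" and sub: "h ` I \<subseteq> span (h' ` I)"
  shows "indep_family h' I"
proof (rule indep_family_if_card_le[OF I])
  fix B assume B: "B \<subseteq> h' ` I" "h' ` I \<subseteq> span B"
  have "finite B" using B(1) I by (simp add: finite_subset)
  moreover have "h ` I \<subseteq> span B"
    using sub span_mono[OF B(2)] by (auto simp: span_span)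
  ultimately have "card (h ` I) \<le> card B"
    using independent_span_bound h by (auto simp: indep_family_def)
  then show "card I \<le> card B"
    using h by (simp add: indep_family_def card_image)
qed

lemma indep_family_if_dim:
  assumes "finite I" "dim (span (h ` I)) = card I"
  shows "indep_family h I"
proof (rule indep_family_if_card_le[OF assms(1)])
  fix B assume "B \<subseteq> h ` I" "independent B" "h ` I \<subseteq> span B"
  then have "dim (h ` I) = card B"
    by (intro dim_unique) auto
  then show "card I \<le> card B" using assms(2) by simp
qed

text \<open>Serves to replace the generator 1 of \<open>U\<close> by -1.\<close>

lemma span_insert_minus: "span (insert (- x) S) = span (insert x S)"
proof (rule span_eq[THEN iffD2], intro conjI)
  show "insert (- x) S \<subseteq> span (insert x S)"
    by (auto intro: span_base span_neg)
  have "- (- x) \<in> span (insert (- x) S)" by (intro span_neg span_base) simp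
  then show "insert x S \<subseteq> span (insert (- x) S)"
    by (auto intro: span_base)
qed

lemma span_family:
  assumes "finite I"
  shows "span (h ` I) = range (\<lambda>c. \<Sum>i\<in>I. c i *s h i)"
proof
  show "range (\<lambda>c. \<Sum>i\<in>I. c i *s h i) \<subseteq> span (h ` I)"
    by (intro image_subsetI span_sum span_scale span_base imageI)
  have "subspace (range (\<lambda>c. \<Sum>i\<in>I. c i *s h i))"
  proof (rule subspaceI)
    show "0 \<in> range (\<lambda>c. \<Sum>i\<in>I. c i *s h i)"
      by (rule range_eqI[of _ _ "\<lambda>_. 0"]) simp
  next
    fix x y assume "x \<in> range (\<lambda>c. \<Sum>i\<in>I. c i *s h i)" "y \<in> range (\<lambda>c. \<Sum>i\<in>I. c i *s h i)"
    then obtain c d where "x = (\<Sum>i\<in>I. c i *s h i)" "y = (\<Sum>i\<in>I. d i *s h i)" by auto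
    then have "x + y = (\<Sum>i\<in>I. (c i + d i) *s h i)"
      by (simp add: scale_left_distrib sum.distrib)
    then show "x + y \<in> range (\<lambda>c. \<Sum>i\<in>I. c i *s h i)" by auto
  next
    fix a x assume "x \<in> range (\<lambda>c. \<Sum>i\<in>I. c i *s h i)"
    then obtain c where "x = (\<Sum>i\<in>I. c i *s h i)" by auto
    then have "a *s x = (\<Sum>i\<in>I. (a * c i) *s h i)"
      by (simp add: scale_sum_right)
    then show "a *s x \<in> range (\<lambda>c. \<Sum>i\<in>I. c i *s h i)" by auto
  qed
  moreover have "h j \<in> range (\<lambda>c. \<Sum>i\<in>I. c i *s h i)" if "j \<in> I" for j
  proof (rule range_eqI)
    show "h j = (\<Sum>i\<in>I. (if i = j then 1 else 0) *s h i)"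
      using assms that by (simp add: if_distrib[of "\<lambda>c. c *s _"] cong: if_cong)
  qed
  ultimately show "span (h ` I) \<subseteq> range (\<lambda>c. \<Sum>i\<in>I. c i *s h i)"
    by (intro span_minimal) auto
qed

section \<open>Counting vectors in spans and independent extensions of tuples\<close>

lemma card_span_indep_family:
  assumes I: "finite I" and ind: "indep_family h I"
  shows "finite (span (h ` I))" and "card (span (h ` I)) = CARD('a) ^ card I"
proof -
  define f where "f c = (\<Sum>i\<in>I. c i *s h i)" for c
  \<comment> \<open>Coefficients outside \<open>I\<close> do not affect the sum, so the finite set
    of extensional coefficient functions already reaches the whole span.\<close>
  have f_restrict: "f c = f (restrict c I)" for c
    unfolding f_def by (intro sum.cong) simp_all
  have "f c \<in> f ` (I \<rightarrow>\<^sub>E UNIV)" for c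
    by (subst f_restrict) (rule imageI, rule restrict_PiE_iff[THEN iffD2], simp)
  then have "f ` (I \<rightarrow>\<^sub>E UNIV) = range f" by blast
  then have im: "f ` (I \<rightarrow>\<^sub>E UNIV) = span (h ` I)"
    unfolding span_family[OF I] f_def[abs_def] .
  have "inj_on f (I \<rightarrow>\<^sub>E UNIV)"
  proof (rule inj_onI)
    fix c d assume cd: "c \<in> I \<rightarrow>\<^sub>E UNIV" "d \<in> I \<rightarrow>\<^sub>E UNIV" and "f c = f d"
    then have "(\<Sum>i\<in>I. (c i - d i) *s h i) = 0"
      by (simp add: f_def scale_left_diff_distrib sum_subtractf)
    then have "\<forall>i\<in>I. c i - d i = 0"
      using ind unfolding indep_family_iff[OF I] by (elim allE[of _ "\<lambda>i. c i - d i"]) simp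
    then show "c = d" using cd by (intro PiE_ext[OF cd]) auto
  qed
  then have "card (span (h ` I)) = card (I \<rightarrow>\<^sub>E (UNIV :: 'a set))"
    by (simp add: card_image flip: im)
  then show "card (span (h ` I)) = CARD('a) ^ card I"
    using I by (simp add: card_PiE)
  show "finite (span (h ` I))"
    using assms by (simp add: finite_PiE flip: im)
qed

text \<open>Each new entry at \<open>Suc i\<close> is any vector of \<open>W\<close> outside the
  span of the \<open>Suc i - s\<close> entries at \<open>s..i\<close>. The start \<open>s\<close> is
  a parameter because entry 0 takes part in independence over GF(q) (\<open>s = 0\<close>) but not
  over the extension field (\<open>s = 1\<close>).\<close>

lemma card_indep_extensions:
  assumes fin: "finite (UNIV :: 'b set)"
    and W: "subspace W" "card W = CARD('a) ^ d"
    and A: "A \<subseteq> extensional {..n}" "\<And>h. h \<in> A \<Longrightarrow> h ` {s..n} \<subseteq> W \<and> indep_family h {s..n}"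
    and "s \<le> Suc n" "n \<le> N"
  shows "card {h \<in> extensional {..N}. restrict h {..n} \<in> A \<and> h ` {n<..N} \<subseteq> W \<and> indep_family h {s..N}}
    = card A * (\<Prod>i=n..<N. CARD('a) ^ d - CARD('a) ^ (Suc i - s))"
  using \<open>n \<le> N\<close>
proof (induction N rule: dec_induct)
  case base
  have "{h \<in> extensional {..n}. restrict h {..n} \<in> A \<and> h ` {n<..n} \<subseteq> W \<and> indep_family h {s..n}} = A"
    using A by (auto simp: extensional_restrict)
  then show ?case by (simp del: restrict_apply)
next
  case (step N)
  let ?S = "\<lambda>N. {h \<in> extensional {..N}. restrict h {..n} \<in> A \<and> h ` {n<..N} \<subseteq> W \<and> indep_family h {s..N}}"
  let ?X = "\<lambda>h. W - span (h ` {s..N})"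
  let ?ext = "\<lambda>(h, x). h(Suc N := x)"
  have sN: "{s..Suc N} = insert (Suc N) {s..N}" "{n<..Suc N} = insert (Suc N) {n<..N}"
    using \<open>s \<le> Suc n\<close> \<open>n \<le> N\<close> by auto
  have hW: "h ` {s..N} \<subseteq> W" if "h \<in> ?S N" for h
  proof -
    have "restrict h {..n} ` {s..n} \<subseteq> W" "h ` {n<..N} \<subseteq> W"
      using that A(2)[of "restrict h {..n}"] by auto
    moreover have "{s..N} \<subseteq> {s..n} \<union> {n<..N}" by auto
    ultimately show ?thesis by (fastforce simp: image_subset_iff)
  qed
  have cX: "card (?X h) = CARD('a) ^ d - CARD('a) ^ (Suc N - s)" if "h \<in> ?S N" for h
    using card_span_indep_family[of "{s..N}" h] that fin W span_minimal[OF hW[OF that] W(1)]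
    by (subst card_Diff_subset) auto
  have finS: "finite (?S N)"
  proof (rule finite_subset)
    show "?S N \<subseteq> {..N} \<rightarrow>\<^sub>E UNIV" by (auto simp: PiE_UNIV_domain PiE_def)
    show "finite ({..N} \<rightarrow>\<^sub>E (UNIV :: 'b set))" using fin by (simp add: finite_PiE)
  qed
  \<comment> \<open>A tuple up to \<open>Suc N\<close> amounts to a tuple up to \<open>N\<close>
    together with an admissible last entry.\<close>
  have "?S (Suc N) = ?ext ` (SIGMA h:?S N. ?X h)"
  proof (intro set_eqI iffI)
    fix h assume h: "h \<in> ?S (Suc N)"
    let ?h = "restrict h {..N}"
    have "restrict ?h {..n} = restrict h {..n}"
      using \<open>n \<le> N\<close> by (auto simp: restrict_def)
    moreover have "indep_family ?h {s..N} \<longleftrightarrow> indep_family h {s..N}"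
      by (rule indep_family_cong) auto
    ultimately have "?h \<in> ?S N" "h (Suc N) \<in> ?X ?h"
      using h by (auto simp: sN indep_family_insert)
    moreover have "h = ?ext (?h, h (Suc N))"
      using h by (auto simp: fun_eq_iff extensional_def)
    ultimately show "h \<in> ?ext ` (SIGMA h:?S N. ?X h)" by blast
  next
    fix h assume "h \<in> ?ext ` (SIGMA h:?S N. ?X h)"
    then obtain g x where g: "g \<in> ?S N" "x \<in> ?X g" "h = g(Suc N := x)" by auto
    have "restrict h {..n} = restrict g {..n}" "h ` {n<..N} = g ` {n<..N}" "h ` {s..N} = g ` {s..N}"
      using g \<open>n \<le> N\<close> by (auto simp: restrict_def)
    moreover have "indep_family h {s..N} \<longleftrightarrow> indep_family g {s..N}"
      by (rule indep_family_cong) (auto simp: g)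
    ultimately show "h \<in> ?S (Suc N)"
      using g by (auto simp: sN indep_family_insert extensional_def)
  qed
  moreover have "inj_on ?ext (SIGMA h:?S N. ?X h)"
  proof (rule inj_onI, clarify)
    fix g x g' x'
    assume g: "g \<in> extensional {..N}" "g' \<in> extensional {..N}" "g(Suc N := x) = g'(Suc N := x')"
    have "g i = g' i" for i
      using g(1,2) fun_cong[OF g(3), of i] by (cases "i = Suc N") (auto simp: extensional_def)
    then show "g = g' \<and> x = x'" using fun_cong[OF g(3), of "Suc N"] by auto
  qed
  ultimately have "card (?S (Suc N)) = card (SIGMA h:?S N. ?X h)"
    by (simp add: card_image)
  also have "\<dots> = (\<Sum>h\<in>?S N. card (?X h))"
    using finS finite_subset[OF subset_UNIV fin] by (intro card_SigmaI) auto
  also have "\<dots> = card (?S N) * (CARD('a) ^ d - CARD('a) ^ (Suc N - s))"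
    using cX by simp
  finally show ?case
    using \<open>n \<le> N\<close> by (simp only: step.IH prod.atLeastLessThan_Suc mult.assoc)
qed

end

section \<open>Field embeddings and restriction of scalars\<close>

lemma field_embedding_simps:
  assumes "field_embedding \<phi>"
  shows "\<phi> 0 = 0" "\<phi> 1 = 1" "\<phi> (x + y) = \<phi> x + \<phi> y" "\<phi> (x * y) = \<phi> x * \<phi> y"
    "\<phi> (- x) = - \<phi> x" "\<phi> x = 0 \<longleftrightarrow> x = 0" "\<phi> (sum f A) = (\<Sum>i\<in>A. \<phi> (f i))"
proof -
  have add: "\<phi> (x + y) = \<phi> x + \<phi> y" and mult: "\<phi> (x * y) = \<phi> x * \<phi> y" and one: "\<phi> 1 = 1" for x y
    using assms by (auto simp: field_embedding_def)
  show zero: "\<phi> 0 = 0" using add[of 0 0] by (simp only: add_0_left add_cancel_right_right)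
  show "\<phi> (- x) = - \<phi> x"
    using add[of x "- x"] zero by (simp add: eq_neg_iff_add_eq_0 add.commute)
  show "\<phi> x = 0 \<longleftrightarrow> x = 0"
    using mult[of x "inverse x"] one zero by (cases "x = 0") auto
  show "\<phi> (sum f A) = (\<Sum>i\<in>A. \<phi> (f i))"
    by (induction A rule: infinite_finite_induct) (auto simp: zero add)
qed (use assms in \<open>auto simp: field_embedding_def\<close>)

lemma vector_space_restrict_scale:
  assumes "field_embedding \<phi>" "vector_space scale"
  shows "vector_space (restrict_scale \<phi> scale)"
proof -
  interpret vector_space scale by fact
  show ?thesis
    by unfold_locales (simp_all add: restrict_scale_def field_embedding_simps[OF assms(1)]
        scale_left_distrib scale_right_distrib)
qed

lemma finite_field_space_restrict_scale:
  fixes \<phi> :: "'k::{field,finite} \<Rightarrow> 'e::field"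
  assumes "field_embedding \<phi>" "vector_space scale"
  shows "finite_field_space (restrict_scale \<phi> scale)"
  using vector_space_restrict_scale[OF assms] by (simp add: finite_field_space_def)

lemma vector_space_mult: "vector_space ((*) :: 'a::field \<Rightarrow> 'a \<Rightarrow> 'a)"
  by unfold_locales (simp_all add: algebra_simps)

text \<open>The elements \<open>- 1, u 1, \<dots>, u r\<close> of the extension field and the spanning vectors
  \<open>t 0, \<dots>, t (k - 1)\<close> of the subspace are indexed compatibly: \<open>t 0\<close> is the
  last vector in the list defining \<open>T(u\<^sub>1, \<dots>, u\<^sub>r)\<close>, and the sign makes
  \<open>\<Sum>j\<le>r. e j t j = 0\<close>.\<close>

locale stabilizer_setup = finite_field_space scale
  for scale :: "'e::{field,finite} \<Rightarrow> 'v::ab_group_add \<Rightarrow> 'v" +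
  fixes \<phi> :: "'k::{field,finite} \<Rightarrow> 'e" and Y :: "nat \<Rightarrow> 'v" and u :: "nat \<Rightarrow> 'e" and m k r :: nat
  assumes embedding: "field_embedding \<phi>"
    and basis: "is_basis scale m Y"
    and r_pos: "1 \<le> r" and r_le: "r \<le> k - 1" and k_le: "k - 1 \<le> m"
    and indep_u: "finite_field_space.indep_family (restrict_scale \<phi> (*)) (\<lambda>i. if i = 0 then - 1 else u i) {..r}"
begin

sublocale F: finite_field_space "restrict_scale \<phi> scale"
  by (rule finite_field_space_restrict_scale[OF embedding vector_space_axioms])

sublocale L: finite_field_space "restrict_scale \<phi> ((*) :: 'e \<Rightarrow> 'e \<Rightarrow> 'e)"
  by (rule finite_field_space_restrict_scale[OF embedding vector_space_mult])

lemmas emb = field_embedding_simps[OF embedding]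

section \<open>The linear relation among the spanning vectors, and independence over the two
  fields\<close>

definition e :: "nat \<Rightarrow> 'e" where "e i = (if i = 0 then - 1 else u i)"

definition t :: "nat \<Rightarrow> 'v" where "t i = (if i = 0 then \<Sum>i=1..r. scale (u i) (Y i) else Y i)"

definition U :: "'e set" where "U = L.span (e ` {..r})"

definition T :: "'v set" where "T = F.span (t ` {..k - 1})"

text \<open>A linear map carries the relation satisfied by \<open>t\<close> to its image tuple. This
  homogeneous form treats entry 0 like the others, as the transposition argument requires;
  \<open>rel_iff\<close> solves it for \<open>h 0\<close>.\<close>

definition rel :: "(nat \<Rightarrow> 'v) \<Rightarrow> bool" where "rel h \<longleftrightarrow> (\<Sum>j\<le>r. scale (e j) (h j)) = 0"

lemma sum_atMost_split: "(\<Sum>i\<le>n. f i) = f 0 + (\<Sum>i=1..n. f i :: 'a::comm_monoid_add)" for n :: nat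
  by (simp add: sum.atLeast_Suc_atMost flip: atLeast0AtMost)

lemma rel_iff: "rel h \<longleftrightarrow> h 0 = (\<Sum>j=1..r. scale (u j) (h j))"
proof -
  have "(\<Sum>j=1..r. scale (e j) (h j)) = (\<Sum>j=1..r. scale (u j) (h j))"
    by (intro sum.cong) (auto simp: e_def)
  then show ?thesis
    by (auto simp: rel_def sum_atMost_split e_def)
qed

lemma rel_cong: "(\<And>j. j \<le> r \<Longrightarrow> h j = h' j) \<Longrightarrow> rel h \<longleftrightarrow> rel h'"
  unfolding rel_def by simp

lemma rel_t: "rel t"
  unfolding rel_iff by (simp add: t_def)

lemma L_indep_e: "L.indep_family e {..r}"
  using indep_u by (simp add: e_def[abs_def])

lemma indep_Y: "indep_family Y {1..m}"
  using basis by (simp add: is_basis_def indep_family_def)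

lemma span_Y: "span (Y ` {1..m}) = UNIV"
  using basis by (simp add: is_basis_def)

lemma finite_V: "finite (UNIV :: 'v set)" and card_V: "CARD('v) = CARD('e) ^ m"
  using card_span_indep_family[OF finite_atLeastAtMost indep_Y] unfolding span_Y by simp_all

lemma indep_t: "indep_family t {1..k - 1}"
proof -
  have "indep_family t {1..k - 1} \<longleftrightarrow> indep_family Y {1..k - 1}"
    by (rule indep_family_cong) (auto simp: t_def)
  then show ?thesis using indep_family_subset[OF indep_Y] k_le by simp
qed

text \<open>Eliminating \<open>h 0\<close> by \<open>rel\<close> leaves a relation among the
  independent \<open>h 1, ..., h N\<close>. So over the extension field every relation is a multiple
  of \<open>e\<close>, extended by zero beyond \<open>r\<close>.\<close>

lemma rel_unique:
  assumes h: "rel h" "indep_family h {1..N}" "r \<le> N"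
    and \<beta>: "(\<Sum>i\<le>N. scale (\<beta> i) (h i)) = 0" and i: "i \<le> N"
  shows "\<beta> i = (if i \<le> r then - \<beta> 0 * e i else 0)"
proof (cases "i = 0")
  case False
  let ?u = "\<lambda>i. if i \<le> r then u i else 0"
  have "(\<Sum>i=1..r. scale (u i) (h i)) = (\<Sum>i=1..N. scale (?u i) (h i))"
    using \<open>r \<le> N\<close> by (intro sum.mono_neutral_cong_left) auto
  then have "h 0 = (\<Sum>i=1..N. scale (?u i) (h i))"
    using h(1) by (simp add: rel_iff)
  then have "(\<Sum>i=1..N. scale (\<beta> i + \<beta> 0 * ?u i) (h i)) = 0"
    using \<beta> by (simp add: sum_atMost_split scale_left_distrib sum.distrib scale_sum_right add.commute)
  then have "\<beta> i + \<beta> 0 * ?u i = 0"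
    using indep_family_unique[OF _ h(2), of "\<lambda>i. \<beta> i + \<beta> 0 * ?u i" "\<lambda>_. 0" i] i False by simp
  then show ?thesis using False by (auto simp: e_def eq_neg_iff_add_eq_0)
qed (simp add: e_def)

text \<open>A relation with coefficients in GF(q) is a multiple of \<open>e\<close>, and its entries
  at 0 and 1 would make 1 and \<open>u 1\<close> dependent over GF(q) unless the multiplier is
  0.\<close>

lemma F_indep_if_rel:
  assumes h: "rel h" "indep_family h {1..N}" "r \<le> N"
  shows "F.indep_family h {..N}"
  unfolding F.indep_family_iff[OF finite_atMost] restrict_scale_def
proof (intro allI impI ballI)
  fix c i assume c: "(\<Sum>i\<le>N. scale (\<phi> (c i)) (h i)) = 0" and i: "i \<in> {..N}"
  note eq = rel_unique[OF h c]
  have "\<phi> (c 1) = - \<phi> (c 0) * u 1"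
    using eq[of 1] r_pos h(3) by (simp add: e_def)
  moreover have "L.indep_family e {0, 1}"
    using L.indep_family_subset[OF L_indep_e] r_pos by auto
  \<comment> \<open>With \<open>e 0 = -1\<close>, the equation reads
    \<open>\<phi> (- c 1) * e 0 + \<phi> (c 0) * e 1 = 0\<close>.\<close>
  ultimately have "c 0 = 0"
    using L.indep_family_unique[of "{0, 1}" e "\<lambda>i. if i = 0 then - c 1 else c 0" "\<lambda>_. 0" 1]
    by (simp add: restrict_scale_def e_def emb)
  then show "c i = 0" using eq[of i] i by (auto simp: emb split: if_splits)
qed

lemma F_indep_t: "F.indep_family t {..k - 1}"
  using F_indep_if_rel[OF rel_t indep_t r_le] .

lemma k_pos: "Suc (k - 1) = k"
  using r_pos r_le by simp

lemma card_T: "card T = CARD('k) ^ k"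
  using F.card_span_indep_family(2)[OF _ F_indep_t] k_pos by (simp add: T_def)

lemma subspace_T: "F.subspace T"
  unfolding T_def by simp

lemma F_span_subset_span: "F.span S \<subseteq> span S"
  by (rule F.span_minimal)
    (auto simp: F.subspace_def restrict_scale_def span_base span_zero span_add span_scale)

text \<open>This is the passage between the two fields: the choices inside \<open>T\<close> are
  counted over GF(q), the later ones over the extension field.\<close>

lemma F_indep_iff_indep:
  assumes h: "rel h" "h ` {..k - 1} \<subseteq> T"
  shows "F.indep_family h {..k - 1} \<longleftrightarrow> indep_family h {1..k - 1}"
proof
  assume ind: "F.indep_family h {..k - 1}"
  have "F.span (h ` {..k - 1}) \<subseteq> T"
    using h(2) subspace_T by (rule F.span_minimal)
  then have span_h: "F.span (h ` {..k - 1}) = T"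
    using F.card_span_indep_family(2)[OF _ ind] k_pos finite_V
    by (intro card_subset_eq) (auto simp: card_T intro: finite_subset)
  have "t ` {1..k - 1} \<subseteq> t ` {..k - 1}" by auto
  also have "\<dots> \<subseteq> T" unfolding T_def by (rule F.span_superset)
  also have "\<dots> \<subseteq> span (h ` {..k - 1})"
    using F_span_subset_span by (simp flip: span_h)
  finally have t_span: "t ` {1..k - 1} \<subseteq> span (h ` {..k - 1})" .
  \<comment> \<open>The relation makes \<open>h 0\<close> redundant, so the \<open>k - 1\<close>
    vectors left span the \<open>k - 1\<close> independent vectors
    \<open>t 1, ..., t (k - 1)\<close>.\<close>
  have "h i \<in> span (h ` {1..k - 1})" if "i \<le> k - 1" for i
  proof (cases "i = 0")
    case True
    have "(\<Sum>j=1..r. scale (u j) (h j)) \<in> span (h ` {1..k - 1})"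
      using r_le by (intro span_sum span_scale span_base imageI) auto
    then show ?thesis
      using h(1) True by (simp add: rel_iff)
  qed (use that in \<open>auto intro: span_base\<close>)
  then have "span (h ` {..k - 1}) \<subseteq> span (h ` {1..k - 1})"
    by (intro span_minimal) auto
  with t_span show "indep_family h {1..k - 1}"
    by (intro indep_family_if_spans[OF _ indep_t]) (simp, rule subset_trans)
qed (use F_indep_if_rel[OF h(1) _ r_le] in blast)

section \<open>The images of the first \<open>r + 1\<close> vectors and the stabilizer in the Singer
  cycle\<close>

text \<open>Only the values at indices up to \<open>r\<close>, for \<open>x\<close> in
  \<open>U\<close>, are determined; all others are arbitrary.\<close>

definition coord :: "'e \<Rightarrow> nat \<Rightarrow> 'k" where
  "coord x = (SOME c. x = (\<Sum>j\<le>r. \<phi> (c j) * e j))"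

lemma in_U_iff: "x \<in> U \<longleftrightarrow> (\<exists>c. x = (\<Sum>j\<le>r. \<phi> (c j) * e j))"
  by (auto simp: U_def L.span_family restrict_scale_def)

lemma coord: "x \<in> U \<Longrightarrow> (\<Sum>j\<le>r. \<phi> (coord x j) * e j) = x"
  unfolding in_U_iff coord_def by (rule sym) (erule someI_ex)

lemma coord_unique:
  assumes "(\<Sum>j\<le>r. \<phi> (c j) * e j) = x" "j \<le> r"
  shows "coord x j = c j"
proof -
  have "x \<in> U" using assms(1) in_U_iff by blast
  then show ?thesis
    using L.indep_family_unique[OF _ L_indep_e, of "coord x" c j] assms
    by (simp add: restrict_scale_def coord)
qed

lemma e_in_U: "i \<le> r \<Longrightarrow> e i \<in> U"
  by (auto simp: U_def intro: L.span_base)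

lemma coord_e: "i \<le> r \<Longrightarrow> j \<le> r \<Longrightarrow> coord (e i) j = (if j = i then 1 else 0)"
  by (rule coord_unique) (auto simp: if_distrib[of \<phi>] if_distrib[of "\<lambda>x. x * _"] emb cong: if_cong)

text \<open>If \<open>a e i = \<Sum>j. M i j e j\<close> for all \<open>i\<close>, then the transposed map
  \<open>t j \<mapsto> \<Sum>i. M i j t i\<close> preserves the relation
  \<open>\<Sum>j. e j t j = 0\<close>, because it replaces \<open>e i\<close> by \<open>a e i\<close>.\<close>

definition tuple_of :: "'e \<Rightarrow> nat \<Rightarrow> 'v" where
  "tuple_of a = (\<lambda>j\<in>{..r}. \<Sum>i\<le>r. scale (\<phi> (coord (a * e i) j)) (t i))"

text \<open>Independence is taken over GF(q), since \<open>rel\<close> is a nontrivial relation over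
  the extension field.\<close>

definition base_tuples :: "(nat \<Rightarrow> 'v) set" where
  "base_tuples = {h \<in> extensional {..r}. rel h \<and> h ` {..r} \<subseteq> T \<and> F.indep_family h {..r}}"

lemma F_indep_t_r: "F.indep_family t {..r}"
  using F.indep_family_subset[OF F_indep_t] r_le by simp

text \<open>The coefficients of \<open>t 0\<close> in the entries are the coordinates of
  \<open>a * e 0 = - a\<close>.\<close>

lemma inj_tuple_of: "inj_on tuple_of {a. a \<noteq> 0 \<and> (*) a ` U = U}"
proof (rule inj_onI)
  fix a b assume a: "a \<in> {a. a \<noteq> 0 \<and> (*) a ` U = U}" and b: "b \<in> {a. a \<noteq> 0 \<and> (*) a ` U = U}"
    and eq: "tuple_of a = tuple_of b"
  have eq0: "coord (a * e 0) j = coord (b * e 0) j" if j: "j \<le> r" for j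
    using F.indep_family_unique[OF _ F_indep_t_r, of "\<lambda>i. coord (a * e i) j" "\<lambda>i. coord (b * e i) j" 0]
      fun_cong[OF eq, of j] j by (simp add: tuple_of_def restrict_scale_def)
  have "a * e 0 \<in> U" "b * e 0 \<in> U" using a b e_in_U[of 0] by auto
  note c = this[THEN coord]
  have "a * e 0 = (\<Sum>j\<le>r. \<phi> (coord (b * e 0) j) * e j)"
    by (subst c(1)[symmetric]) (simp add: eq0)
  also have "\<dots> = b * e 0" by (rule c(2))
  finally have "a * e 0 = b * e 0" .
  then show "a = b" by (simp add: e_def)
qed

text \<open>Independence of the entries reflects that multiplication by \<open>a\<close> maps
  \<open>U\<close> onto \<open>U\<close>, so that its transposed matrix is injective.\<close>

lemma tuple_of_in_base_tuples:
  assumes a: "(*) a ` U = U"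
  shows "tuple_of a \<in> base_tuples"
proof -
  let ?h = "tuple_of a"
  have aU: "a * e i \<in> U" if "i \<le> r" for i using a e_in_U[OF that] by auto
  have h: "?h j = (\<Sum>i\<le>r. scale (\<phi> (coord (a * e i) j)) (t i))" if "j \<le> r" for j
    using that by (simp add: tuple_of_def)
  have "(\<Sum>j\<le>r. scale (e j) (?h j)) = (\<Sum>j\<le>r. \<Sum>i\<le>r. scale (\<phi> (coord (a * e i) j) * e j) (t i))"
    by (simp add: h scale_sum_right mult.commute)
  also have "\<dots> = (\<Sum>i\<le>r. \<Sum>j\<le>r. scale (\<phi> (coord (a * e i) j) * e j) (t i))"
    by (rule sum.swap)
  also have "\<dots> = (\<Sum>i\<le>r. scale (a * e i) (t i))"
    by (simp add: coord aU flip: scale_sum_left)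
  also have "\<dots> = scale a (\<Sum>i\<le>r. scale (e i) (t i))"
    by (simp add: scale_sum_right)
  also have "\<dots> = 0" using rel_t by (simp add: rel_def)
  finally have "rel ?h" by (simp add: rel_def)
  moreover have "?h j \<in> T" if "j \<le> r" for j
  proof -
    have "(\<Sum>i\<le>r. restrict_scale \<phi> scale (coord (a * e i) j) (t i)) \<in> T"
      unfolding T_def using r_le by (intro F.span_sum F.span_scale F.span_base) auto
    then show ?thesis using that by (simp add: h restrict_scale_def)
  qed
  moreover have "F.indep_family ?h {..r}"
    unfolding F.indep_family_iff[OF finite_atMost] restrict_scale_def
  proof (intro allI impI ballI)
    fix c l assume c: "(\<Sum>j\<le>r. scale (\<phi> (c j)) (?h j)) = 0" and "l \<in> {..r}"
    then have l: "l \<le> r" by simp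
    have "(\<Sum>i\<le>r. scale (\<phi> (\<Sum>j\<le>r. c j * coord (a * e i) j)) (t i))
        = (\<Sum>i\<le>r. \<Sum>j\<le>r. scale (\<phi> (c j) * \<phi> (coord (a * e i) j)) (t i))"
      by (simp add: emb scale_sum_left)
    also have "\<dots> = (\<Sum>j\<le>r. \<Sum>i\<le>r. scale (\<phi> (c j) * \<phi> (coord (a * e i) j)) (t i))"
      by (rule sum.swap)
    also have "\<dots> = 0" using c by (simp add: h scale_sum_right)
    \<comment> \<open>The functional with coefficients \<open>c\<close> on coordinates vanishes at
      every \<open>a * e i\<close>. These span \<open>a U = U\<close>, so it vanishes at
      \<open>e l\<close>, where its value is \<open>c l\<close>.\<close>
    finally have ci: "(\<Sum>j\<le>r. c j * coord (a * e i) j) = 0" if "i \<le> r" for i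
      using that F.indep_family_unique[OF _ F_indep_t_r, of "\<lambda>i. \<Sum>j\<le>r. c j * coord (a * e i) j" "\<lambda>_. 0" i]
      by (simp add: restrict_scale_def emb)
    obtain y where y: "y \<in> U" "e l = a * y" using a e_in_U[OF l] by auto
    have "coord (e l) j = (\<Sum>i\<le>r. coord y i * coord (a * e i) j)" if "j \<le> r" for j
    proof (rule coord_unique[OF _ that])
      have "(\<Sum>j\<le>r. \<phi> (\<Sum>i\<le>r. coord y i * coord (a * e i) j) * e j)
          = (\<Sum>j\<le>r. \<Sum>i\<le>r. \<phi> (coord y i) * (\<phi> (coord (a * e i) j) * e j))"
        by (simp add: emb sum_distrib_right mult.assoc)
      also have "\<dots> = (\<Sum>i\<le>r. \<Sum>j\<le>r. \<phi> (coord y i) * (\<phi> (coord (a * e i) j) * e j))"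
        by (rule sum.swap)
      also have "\<dots> = (\<Sum>i\<le>r. \<phi> (coord y i) * (a * e i))"
        by (simp add: coord aU flip: sum_distrib_left)
      also have "\<dots> = a * (\<Sum>i\<le>r. \<phi> (coord y i) * e i)"
        by (simp add: sum_distrib_left mult.left_commute)
      finally show "(\<Sum>j\<le>r. \<phi> (\<Sum>i\<le>r. coord y i * coord (a * e i) j) * e j) = e l"
        using y by (simp add: coord)
    qed
    then have "(\<Sum>j\<le>r. c j * coord (e l) j) = (\<Sum>j\<le>r. \<Sum>i\<le>r. coord y i * (c j * coord (a * e i) j))"
      by (simp add: sum_distrib_left mult.left_commute)
    also have "\<dots> = (\<Sum>i\<le>r. \<Sum>j\<le>r. coord y i * (c j * coord (a * e i) j))"
      by (rule sum.swap)
    also have "\<dots> = 0" by (simp add: ci flip: sum_distrib_left)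
    finally show "c l = 0"
      using l by (simp add: coord_e if_distrib[of "\<lambda>x. _ * x"] cong: if_cong)
  qed
  ultimately show ?thesis
    by (auto simp: base_tuples_def tuple_of_def)
qed

text \<open>Expanding the entries of \<open>h\<close> in the vectors \<open>t i\<close> turns
  \<open>rel h\<close> into a relation among the \<open>t i\<close>. By \<open>rel_unique\<close>
  its coefficients are those of \<open>e\<close> times a scalar \<open>a\<close>, which identifies
  the coefficient matrix.\<close>

lemma base_tuples_subset: "base_tuples \<subseteq> tuple_of ` {a. a \<noteq> 0 \<and> (*) a ` U = U}"
proof
  fix h assume "h \<in> base_tuples"
  then have h: "h \<in> extensional {..r}" "rel h" "\<And>j. j \<le> r \<Longrightarrow> h j \<in> T" "F.indep_family h {..r}"
    by (auto simp: base_tuples_def)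
  have "\<forall>j. \<exists>c. j \<le> r \<longrightarrow> h j = (\<Sum>i\<le>k - 1. scale (\<phi> (c i)) (t i))"
    using h(3) by (auto simp: T_def F.span_family restrict_scale_def)
  then obtain M where M: "\<And>j. j \<le> r \<Longrightarrow> h j = (\<Sum>i\<le>k - 1. scale (\<phi> (M j i)) (t i))"
    by metis
  define \<beta> where "\<beta> i = (\<Sum>j\<le>r. \<phi> (M j i) * e j)" for i
  \<comment> \<open>The sign comes from \<open>e 0 = -1\<close>: this makes
    \<open>\<beta> 0 = a * e 0\<close>.\<close>
  define a where "a = - \<beta> 0"
  have "(\<Sum>i\<le>k - 1. scale (\<beta> i) (t i)) = (\<Sum>i\<le>k - 1. \<Sum>j\<le>r. scale (e j) (scale (\<phi> (M j i)) (t i)))"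
    by (simp add: \<beta>_def scale_sum_left mult.commute)
  also have "\<dots> = (\<Sum>j\<le>r. \<Sum>i\<le>k - 1. scale (e j) (scale (\<phi> (M j i)) (t i)))"
    by (rule sum.swap)
  also have "\<dots> = (\<Sum>j\<le>r. scale (e j) (h j))"
    by (simp add: M scale_sum_right)
  also have "\<dots> = 0" using h(2) by (simp add: rel_def)
  finally have \<beta>: "\<beta> i = (if i \<le> r then a * e i else 0)" if "i \<le> k - 1" for i
    using rel_unique[OF rel_t indep_t r_le _ that, of \<beta>] by (simp add: a_def)
  have ae: "(\<Sum>j\<le>r. \<phi> (M j i) * e j) = a * e i" if "i \<le> r" for i
    using \<beta>[of i] that r_le by (simp add: \<beta>_def)
  have aeU: "a * e i \<in> U" if "i \<le> r" for i
    unfolding in_U_iff by (rule exI[of _ "\<lambda>j. M j i"], rule ae[OF that, symmetric])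
  have Mc: "M j i = coord (a * e i) j" if "i \<le> r" "j \<le> r" for i j
    using coord_unique[OF ae[OF that(1)] that(2)] by (rule sym)
  \<comment> \<open>Beyond \<open>r\<close>, \<open>\<beta> i = 0\<close> is a GF(q)-relation among
    the independent \<open>e j\<close>, so the entries of \<open>h\<close> involve only
    \<open>t 0, ..., t r\<close>.\<close>
  have M0: "M j i = 0" if "r < i" "i \<le> k - 1" "j \<le> r" for i j
    using \<beta>[of i] that L.indep_family_unique[OF _ L_indep_e, of "\<lambda>j. M j i" "\<lambda>_. 0" j]
    by (simp add: \<beta>_def restrict_scale_def emb)
  have hj: "h j = (\<Sum>i\<le>r. scale (\<phi> (coord (a * e i) j)) (t i))" if "j \<le> r" for j
  proof -
    have "(\<Sum>i\<le>k - 1. scale (\<phi> (M j i)) (t i)) = (\<Sum>i\<le>r. scale (\<phi> (coord (a * e i) j)) (t i))"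
      using that r_le by (intro sum.mono_neutral_cong_right) (auto simp: M0 Mc emb)
    then show ?thesis using M[OF that] by simp
  qed
  have "a \<noteq> 0"
  proof
    assume "a = 0"
    moreover have "coord 0 0 = 0" using coord_unique[of "\<lambda>_. 0" 0 0] by (simp add: emb)
    ultimately have "h 0 = 0" using hj[of 0] by (simp add: emb)
    then show False
      using h(4) F.dependent_zero[of "h ` {..r}"] by (force simp: F.indep_family_def)
  qed
  have "(*) a ` U \<subseteq> U"
  proof clarify
    fix x assume "x \<in> U"
    then have "a * x = (\<Sum>i\<le>r. restrict_scale \<phi> (*) (coord x i) (a * e i))"
      using coord[of x] by (simp add: restrict_scale_def mult.left_commute flip: sum_distrib_left)
    also have "\<dots> \<in> U"
      using aeU unfolding U_def by (intro L.span_sum L.span_scale) auto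
    finally show "a * x \<in> U" .
  qed
  \<comment> \<open>An injective map of a finite set into itself is onto.\<close>
  then have "(*) a ` U = U"
    using \<open>a \<noteq> 0\<close> by (intro card_subset_eq) (auto simp: card_image inj_on_def)
  moreover have "h = tuple_of a"
    using h(1) hj by (auto simp: tuple_of_def extensional_def)
  ultimately show "h \<in> tuple_of ` {a. a \<noteq> 0 \<and> (*) a ` U = U}"
    using \<open>a \<noteq> 0\<close> by blast
qed

lemma card_base_tuples: "card base_tuples = card (stabilizer singer_cycle U)"
proof -
  have "base_tuples = tuple_of ` {a. a \<noteq> 0 \<and> (*) a ` U = U}"
    using base_tuples_subset tuple_of_in_base_tuples by auto
  then have "card base_tuples = card {a. a \<noteq> 0 \<and> (*) a ` U = U}"
    by (simp add: card_image inj_tuple_of)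
  also have "\<dots> = card ((*) ` {a. a \<noteq> 0 \<and> (*) a ` U = U})"
  proof (rule card_image[symmetric], rule inj_onI)
    fix a b :: 'e assume "(*) a = (*) b"
    then show "a = b" by (metis mult.right_neutral)
  qed
  also have "(*) ` {a. a \<noteq> 0 \<and> (*) a ` U = U} = stabilizer singer_cycle U"
    by (auto simp: stabilizer_def singer_cycle_def)
  finally show ?thesis .
qed

section \<open>Extending the tuples first inside \<open>T\<close>, then in the whole space\<close>

definition T_tuples :: "(nat \<Rightarrow> 'v) set" where
  "T_tuples = {h \<in> extensional {..k - 1}. rel h \<and> h ` {..k - 1} \<subseteq> T \<and> indep_family h {1..k - 1}}"

definition V_tuples :: "(nat \<Rightarrow> 'v) set" where
  "V_tuples = {h \<in> extensional {..m}. rel h \<and> h ` {..k - 1} \<subseteq> T \<and> indep_family h {1..m}}"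

text \<open>After the switch to independence over GF(q), entry 0 counts among the earlier vectors;
  hence the exponent \<open>Suc i\<close>.\<close>

lemma card_T_tuples:
  "card T_tuples = card base_tuples * (\<Prod>i=r..<k - 1. CARD('k) ^ k - CARD('k) ^ Suc i)"
proof -
  have "rel (restrict h {..r}) \<longleftrightarrow> rel h" for h
    by (rule rel_cong) simp
  moreover have "F.indep_family (restrict h {..r}) {..r} \<longleftrightarrow> F.indep_family h {..r}" for h
    by (rule F.indep_family_cong) simp
  moreover have "F.indep_family h {..k - 1} \<Longrightarrow> F.indep_family h {..r}" for h
    using F.indep_family_subset r_le by (metis atMost_subset_iff)
  moreover have "h ` {..k - 1} \<subseteq> T \<longleftrightarrow> h ` {..r} \<subseteq> T \<and> h ` {r<..k - 1} \<subseteq> T" for h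
    using r_le by (simp only: flip: image_Un Un_subset_iff) (simp add: ivl_disj_un)
  ultimately have "T_tuples = {h \<in> extensional {..k - 1}. restrict h {..r} \<in> base_tuples \<and>
      h ` {r<..k - 1} \<subseteq> T \<and> F.indep_family h {0..k - 1}}"
    using F_indep_iff_indep by (auto simp: T_tuples_def base_tuples_def atLeast0AtMost simp del: restrict_apply)
  moreover have "base_tuples \<subseteq> extensional {..r}"
    "\<And>h. h \<in> base_tuples \<Longrightarrow> h ` {0..r} \<subseteq> T \<and> F.indep_family h {0..r}"
    by (auto simp: base_tuples_def atLeast0AtMost)
  ultimately show ?thesis
    using F.card_indep_extensions[OF finite_V subspace_T card_T, of base_tuples r 0 "k - 1"] r_le by simp
qed

text \<open>Over the extension field entry 0 is left out, so only \<open>i\<close> earlier vectors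
  span the forbidden subspace.\<close>

lemma card_V_tuples:
  "card V_tuples = card T_tuples * (\<Prod>i=k - 1..<m. (CARD('e) ^ m - CARD('e) ^ i))"
proof -
  have "rel (restrict h {..k - 1}) \<longleftrightarrow> rel h" for h
    using r_le by (intro rel_cong) simp
  moreover have "indep_family (restrict h {..k - 1}) {1..k - 1} \<longleftrightarrow> indep_family h {1..k - 1}" for h
    by (rule indep_family_cong) simp
  moreover have "indep_family h {1..m} \<Longrightarrow> indep_family h {1..k - 1}" for h
    using indep_family_subset k_le by (metis atLeastatMost_subset_iff order_refl)
  ultimately have "V_tuples = {h \<in> extensional {..m}. restrict h {..k - 1} \<in> T_tuples \<and>
      h ` {k - 1<..m} \<subseteq> UNIV \<and> indep_family h {1..m}}"
    by (auto simp: T_tuples_def V_tuples_def simp del: restrict_apply)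
  moreover have *: "T_tuples \<subseteq> extensional {..k - 1}"
    "\<And>h. h \<in> T_tuples \<Longrightarrow> h ` {1..k - 1} \<subseteq> UNIV \<and> indep_family h {1..k - 1}"
    by (auto simp: T_tuples_def)
  ultimately show ?thesis
    using card_indep_extensions[OF finite_V subspace_UNIV card_V *, of m] k_le by simp
qed

section \<open>Stabilizer elements as tuples of images\<close>

lemma inj_on_GL_tuples: "inj_on (\<lambda>g. restrict (g \<circ> t) {..m}) (GL scale)"
proof (rule inj_onI, rule ext)
  fix g g' x
  assume g: "g \<in> GL scale" "g' \<in> GL scale" and eq: "restrict (g \<circ> t) {..m} = restrict (g' \<circ> t) {..m}"
  interpret vector_space_pair scale scale ..
  have "g y = g' y" if "y \<in> Y ` {1..m}" for y
  proof -
    obtain i where "i \<in> {1..m}" "y = Y i" using \<open>y \<in> Y ` {1..m}\<close> by auto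
    then show ?thesis using fun_cong[OF eq, of i] by (simp add: t_def)
  qed
  then show "g x = g' x"
    using g by (intro linear_eq_on[of g g' x "Y ` {1..m}"]) (simp_all only: GL_def mem_Collect_eq span_Y UNIV_I)
qed

lemma F_linear: "Vector_Spaces.linear scale scale g \<Longrightarrow>
    Vector_Spaces.linear (restrict_scale \<phi> scale) (restrict_scale \<phi> scale) g"
  by (simp add: Vector_Spaces.linear_iff restrict_scale_def F.vector_space_axioms)

lemma GL_tuples:
  "(\<lambda>g. restrict (g \<circ> t) {..m}) ` stabilizer (GL scale) T = V_tuples"
proof (intro set_eqI iffI)
  fix h assume "h \<in> (\<lambda>g. restrict (g \<circ> t) {..m}) ` stabilizer (GL scale) T"
  then obtain g where g: "Vector_Spaces.linear scale scale g" "bij g" "g ` T = T"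
    and h: "h = restrict (g \<circ> t) {..m}"
    by (auto simp: stabilizer_def GL_def)
  interpret g: Vector_Spaces.linear scale scale g by (fact g(1))
  have hi: "h i = g (t i)" if "i \<le> m" for i using that by (simp add: h)
  have "(\<Sum>j\<le>r. scale (e j) (h j)) = g (\<Sum>j\<le>r. scale (e j) (t j))"
    using r_le k_le by (simp add: hi g.sum g.scale)
  then have "rel h" using rel_t by (simp add: rel_def g.zero)
  moreover have "h ` {..k - 1} \<subseteq> T"
  proof (rule image_subsetI)
    fix i assume "i \<in> {..k - 1}"
    then have "h i = g (t i)" "t i \<in> T" using k_le by (auto simp: hi T_def intro: F.span_base)
    then show "h i \<in> T" using g(3) by auto
  qed
  moreover have "indep_family h {1..m}"
    unfolding indep_family_iff[OF finite_atLeastAtMost]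
  proof (intro allI impI)
    fix c assume "(\<Sum>i=1..m. scale (c i) (h i)) = 0"
    then have "g (\<Sum>i=1..m. scale (c i) (Y i)) = g 0"
      by (simp add: hi t_def g.sum g.scale g.zero)
    then have "(\<Sum>i=1..m. scale (c i) (Y i)) = 0"
      using bij_is_inj[OF g(2)] by (simp only: inj_eq)
    then show "\<forall>i\<in>{1..m}. c i = 0"
      using indep_Y[unfolded indep_family_iff[OF finite_atLeastAtMost]] by blast
  qed
  ultimately show "h \<in> V_tuples" by (simp add: V_tuples_def h)
next
  fix h assume "h \<in> V_tuples"
  then have h: "h \<in> extensional {..m}" "rel h" "h ` {..k - 1} \<subseteq> T" "indep_family h {1..m}"
    by (auto simp: V_tuples_def)
  interpret vector_space_pair scale scale ..
  have injY: "inj_on Y {1..m}" and "independent (Y ` {1..m})"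
    using indep_Y by (auto simp: indep_family_def)
  then obtain g where g: "Vector_Spaces.linear scale scale g"
    and gY: "\<And>y. y \<in> Y ` {1..m} \<Longrightarrow> g y = h (the_inv_into {1..m} Y y)"
    using linear_independent_extend[of "Y ` {1..m}" "\<lambda>y. h (the_inv_into {1..m} Y y)"] by blast
  interpret g: Vector_Spaces.linear scale scale g by (fact g)
  interpret gF: Vector_Spaces.linear "restrict_scale \<phi> scale" "restrict_scale \<phi> scale" g
    by (rule F_linear[OF g])
  have gYi: "g (Y i) = h i" if "i \<in> {1..m}" for i
    using gY[OF imageI[OF that]] by (simp only: the_inv_into_f_f[OF injY that])
  have gt: "g (t i) = h i" if "i \<le> m" for i
  proof (cases "i = 0")
    case True
    then show ?thesis
      using h(2) r_le k_le by (simp add: t_def rel_iff g.sum g.scale gYi)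
  qed (use that gYi[of i] in \<open>simp add: t_def\<close>)
  \<comment> \<open>The \<open>m\<close> independent images span as many vectors as the whole space
    has, so \<open>g\<close> is onto, and bijective by finiteness.\<close>
  have "card (span (h ` {1..m})) = CARD('v)"
    using card_span_indep_family(2)[OF _ h(4)] by (simp add: card_V)
  then have "span (h ` {1..m}) = UNIV"
    using finite_V by (intro card_subset_eq) auto
  moreover have "h ` {1..m} = g ` Y ` {1..m}"
    using gYi by (simp add: image_image)
  moreover have "span (g ` Y ` {1..m}) = range g"
    by (simp only: g.span_image span_Y)
  ultimately have "surj g" by simp
  then have bij: "bij g"
    using finite_UNIV_surj_inj[OF finite_V] by (simp add: bij_def)
  have "g ` t ` {..k - 1} = h ` {..k - 1}"
    using gt k_le by (simp add: image_image)
  then have "g ` T = F.span (h ` {..k - 1})"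
    by (simp add: T_def flip: gF.span_image)
  also have "\<dots> \<subseteq> T"
    using h(3) subspace_T by (rule F.span_minimal)
  finally have "g ` T \<subseteq> T" .
  moreover have "card (g ` T) = card T"
    by (rule card_image[OF inj_on_subset[OF bij_is_inj[OF bij] subset_UNIV]])
  ultimately have "g ` T = T"
    by (rule card_subset_eq[OF finite_subset[OF subset_UNIV finite_V]])
  moreover have "h = restrict (g \<circ> t) {..m}"
    using h(1) gt by (auto simp: extensional_def)
  ultimately show "h \<in> (\<lambda>g. restrict (g \<circ> t) {..m}) ` stabilizer (GL scale) T"
    using g bij by (auto simp: stabilizer_def GL_def)
qed

lemma card_stabilizer:
  "card (stabilizer (GL scale) T) = card (stabilizer singer_cycle U) *
    (\<Prod>i=r..<k - 1. CARD('k) ^ k - CARD('k) ^ Suc i) * (\<Prod>i=k - 1..<m. CARD('e) ^ m - CARD('e) ^ i)"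
proof -
  have "inj_on (\<lambda>g. restrict (g \<circ> t) {..m}) (stabilizer (GL scale) T)"
    using inj_on_GL_tuples by (rule inj_on_subset) (auto simp: stabilizer_def)
  then have "card (stabilizer (GL scale) T) = card V_tuples"
    by (simp add: card_image flip: GL_tuples)
  then show ?thesis
    by (simp add: card_V_tuples card_T_tuples card_base_tuples)
qed

lemma T_subspace_eq: "T_subspace \<phi> scale Y k r u = T"
proof -
  have "{..k - 1} = insert 0 {1..k - 1}" by auto
  moreover have "t ` {1..k - 1} = Y ` {1..k - 1}" by (intro image_cong) (auto simp: t_def)
  ultimately have "t ` {..k - 1} = insert (\<Sum>i=1..r. scale (u i) (Y i)) (Y ` {1..k - 1})"
    by (simp only: image_insert) (simp add: t_def)
  then show ?thesis by (simp add: T_subspace_def T_def)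
qed

end

section \<open>The stabilizer formula in terms of \<open>q\<close> and \<open>l\<close>\<close>

theorem lemma3p6:
  fixes q m l k r :: nat
    and \<phi> :: "'k::{field,finite} \<Rightarrow> 'e::{field,finite}"
    and scale :: "'e \<Rightarrow> 'v::ab_group_add \<Rightarrow> 'v"
    and Y :: "nat \<Rightarrow> 'v"
    and u :: "nat \<Rightarrow> 'e"
  defines "U \<equiv> module.span (restrict_scale \<phi> (*)) (insert 1 (u ` {1..r}))"
  assumes "primepow q"
    and "CARD('k) = q"
    and "CARD('e) = q ^ l"
    and "field_embedding \<phi>"
    and "vector_space scale"
    and "is_basis scale m Y"
    and "3 \<le> k"
    and "k \<le> min (m + 1) l"
    and "1 \<le> r"
    and "r \<le> k - 1"
    and "vector_space.dim (restrict_scale \<phi> (*)) U = r + 1"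
  shows "card (stabilizer (GL scale) (T_subspace \<phi> scale Y k r u)) =
      card (stabilizer singer_cycle U) *
      (\<Prod>i=r+1..k-1. q ^ k - q ^ i) * (\<Prod>i=k-1..m-1. q ^ (m * l) - q ^ (i * l))"
proof -
  have k: "1 \<le> r" "r \<le> k - 1" "k - 1 \<le> m" "1 \<le> m"
    using assms(8-11) by auto
  interpret L: finite_field_space "restrict_scale \<phi> ((*) :: 'e \<Rightarrow> 'e \<Rightarrow> 'e)"
    by (rule finite_field_space_restrict_scale[OF assms(5) vector_space_mult])
  define e' where "e' i = (if i = 0 then - 1 else u i)" for i :: nat
  have e'_image: "e' ` {..r} = insert (- 1) (u ` {1..r})"
  proof -
    have "{..r} = insert 0 {1..r}" by auto
    moreover have "e' ` {1..r} = u ` {1..r}" by (intro image_cong) (auto simp: e'_def)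
    ultimately show ?thesis by (simp only: image_insert) (simp add: e'_def)
  qed
  then have U: "U = L.span (e' ` {..r})"
    using L.span_insert_minus unfolding U_def by simp
  \<comment> \<open>The \<open>r + 1\<close> generators span a space of dimension
    \<open>r + 1\<close>.\<close>
  have "L.indep_family e' {..r}"
    using assms(12) unfolding U by (intro L.indep_family_if_dim) auto
  then interpret S: stabilizer_setup scale \<phi> Y u m k r
    using assms(5-7) k by (intro stabilizer_setup.intro stabilizer_setup_axioms.intro)
      (simp_all add: finite_field_space_def e'_def[abs_def])
  have "S.e = e'"
    by (simp add: fun_eq_iff S.e_def e'_def)
  then have S_U: "S.U = U"
    by (simp add: S.U_def U)
  have "card (stabilizer (GL scale) (T_subspace \<phi> scale Y k r u)) = card (stabilizer singer_cycle U) *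
      (\<Prod>i=r..<k - 1. q ^ k - q ^ Suc i) * (\<Prod>i=k - 1..<m. (q ^ l) ^ m - (q ^ l) ^ i)"
    using S.card_stabilizer assms(3,4) by (simp only: S.T_subspace_eq S_U)
  also have "(\<Prod>i=r..<k - 1. q ^ k - q ^ Suc i) = (\<Prod>i=r + 1..k - 1. q ^ k - q ^ i)"
    by (simp only: Suc_eq_plus1[symmetric] atLeastLessThanSuc_atLeastAtMost[symmetric]
        prod.shift_bounds_Suc_ivl)
  also have "(\<Prod>i=k - 1..<m. (q ^ l) ^ m - (q ^ l) ^ i) = (\<Prod>i=k - 1..m - 1. q ^ (m * l) - q ^ (i * l))"
  proof -
    \<comment> \<open>Since \<open>m\<close> is positive, the natural-number subtraction
      \<open>m - 1\<close> does not truncate.\<close>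
    have "{k - 1..<m} = {k - 1..m - 1}" using k(4) by auto
    then show ?thesis by (simp add: mult.commute flip: power_mult)
  qed
  finally show ?thesis .
qed

end
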